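(* Let $F$ be a field, let $L$ be a finite-dimensional left Leibniz algebra over $F$, and let $V \neq 0$ be a finite-dimensional $L$-bimodule, with left action $T$ and right action $S$, i.e. $T_a(v) = av$ and $S_a(v) = va$ for $a \in L$, $v \in V$. Suppose that $T_a$ is a nilpotent linear map of $V$ for every $a \in L$. Then $S_a$ is nilpotent for every $a \in L$, and there exists $v \in V$, $v \neq 0$, such that $T_a(v) = S_a(v) = 0$ for all $a \in L$.
   Context: A left Leibniz algebra over $F$ is a vector space $L$ with a bilinear product $(x,y)\mapsto xy$ satisfying the left Leibniz identity $x(yz) = (xy)z + y(xz)$ for all $x,y,z \in L$. An $L$-bimodule (equivalently, a representation $(S,T)$ of $L$) is a vector space $V$ together with bilinear maps $L \times V \to V$, $(a,v)\mapsto av$, and $V \times L \to V$, $(v,a) \mapsto va$, such that the split extension $X = V \oplus L$ with product $(v+a)(w+b) = (aw + vb) + ab$ (for $v,w\in V$, $a,b \in L$) is a left Leibniz algebra. *)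

theory Defs
  imports Complex_Main "HOL-Library.Product_Plus"
begin

text \<open>Left Leibniz identity x(yz) = (xy)z + y(xz) for a product m.\<close>
definition left_leibniz :: "('a::plus \<Rightarrow> 'a \<Rightarrow> 'a) \<Rightarrow> bool" where
  "left_leibniz m \<longleftrightarrow> (\<forall>x y z. m x (m y z) = m (m x y) z + m y (m x z))"

text \<open>Split extension X = V \<oplus> L, with (v+a)(w+b) = (aw + vb) + ab;
  T is the left action (a,v) \<mapsto> av, S the right action (v,a) \<mapsto> va.\<close>
definition split_ext_mult ::
  "('l \<Rightarrow> 'l \<Rightarrow> 'l) \<Rightarrow> ('l \<Rightarrow> 'v::plus \<Rightarrow> 'v) \<Rightarrow> ('v \<Rightarrow> 'l \<Rightarrow> 'v)
     \<Rightarrow> 'v \<times> 'l \<Rightarrow> 'v \<times> 'l \<Rightarrow> 'v \<times> 'l" where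
  "split_ext_mult m T S x y = (T (snd x) (fst y) + S (fst x) (snd y), m (snd x) (snd y))"

text \<open>A (linear) map is nilpotent if some power of it is zero.\<close>
definition nilpotent_map :: "('v \<Rightarrow> 'v::zero) \<Rightarrow> bool" where
  "nilpotent_map f \<longleftrightarrow> (\<exists>n. (f ^^ n) = (\<lambda>_. 0))"

end

theory Submission
  imports Defs
begin

(* Proof idea.  Write T_a v = av and S_a v = va.  Unfolding the left Leibniz identity of the
   split extension V + L on the three mixed triples gives
     T_a T_b = T_(ab) + T_b T_a,   T_a S_c = S_c T_a + S_(ac),   S_(bc) = S_c S_b + T_b S_c,
   and the last two combine to S_c S_b = - S_c T_b.  With b = c = a this yields
   S_a^(k+1) = +/- S_a T_a^k, so S_a is nilpotent whenever T_a is.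
   For the common null vector we prove Engel's theorem for representations of a finite-dimensional
   Leibniz algebra: J = ker T is an ideal containing all squares aa and all ab + ba, and ad_b is
   nilpotent modulo J because T_(b^k a) = (ad T_b)^k T_a.  Engel's theorem is proved without
   quotients, for a subalgebra K over J acting nilpotently on a set U modulo a subspace U', by
   induction on dim K: a maximal proper subalgebra H of K containing J is normalised by some a
   (the adjoint case of the induction), so K = H + Fa, and a null vector of H is moved to a null
   vector of K by iterating the action of a.  Finally, a nonzero v killed by every T_a is killed
   by every S_a, or else some S_v b is a nonzero element of the T-invariant subspace
   {u. S_u = 0}, to which Engel's theorem applies once more. *)

section \<open>Preliminaries on iterates and additive maps\<close>

text \<open>If an iterate of f starts in an f-invariant set W outside P and ends in P, then some point
  of W outside P is mapped into P by a single application of f.\<close>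
lemma funpow_exit:
  assumes "\<forall>w\<in>W. f w \<in> W" "u \<in> W" "u \<notin> P" "(f ^^ k) u \<in> P"
  shows "\<exists>w\<in>W. w \<notin> P \<and> f w \<in> P"
  using assms(2-4)
proof (induction k arbitrary: u)
  case 0
  then show ?case by simp
next
  case (Suc k)
  show ?case
  proof (cases "f u \<in> P")
    case True
    then show ?thesis using Suc by blast
  next
    case False
    have "(f ^^ k) (f u) \<in> P" using Suc(4) by (simp add: funpow_swap1)
    then show ?thesis using Suc.IH[of "f u"] False assms(1) Suc(2) by blast
  qed
qed

lemma funpow_fix_zero:
  fixes X :: "'v::zero \<Rightarrow> 'v"
  shows "X 0 = 0 \<Longrightarrow> (X ^^ i) 0 = 0"
  by (induction i) simp_all

text \<open>Iterates of a map fixing 0 vanish from the nilpotency index on.\<close>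
lemma funpow_beyond_nil:
  fixes X :: "'v::zero \<Rightarrow> 'v"
  assumes Xn: "X ^^ n = (\<lambda>_. 0)" and X0: "X 0 = 0" and "n \<le> i"
  shows "(X ^^ i) w = 0"
proof -
  have "(X ^^ i) w = (X ^^ (i - n)) ((X ^^ n) w)"
    using \<open>n \<le> i\<close> by (metis comp_apply funpow_add le_add_diff_inverse2)
  then show ?thesis using Xn funpow_fix_zero[of X, OF X0] by simp
qed

text \<open>Additive maps between abelian groups preserve 0, negation and differences.\<close>
lemma additive_facts:
  fixes f :: "'a::ab_group_add \<Rightarrow> 'b::ab_group_add"
  assumes "\<And>x y. f (x + y) = f x + f y"
  shows "f 0 = 0" "f (- x) = - f x" "f (x - y) = f x - f y"
proof -
  interpret additive f by unfold_locales (rule assms)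
  show "f 0 = 0" "f (- x) = - f x" "f (x - y) = f x - f y" by (simp_all add: zero minus diff)
qed

text \<open>A vector space spanned by a finite set is finite-dimensional (with an explicit basis).\<close>
lemma finite_dimensional_from_finite_span:
  assumes vs: "vector_space s" and fin: "\<exists>B. finite B \<and> module.span s B = UNIV"
  obtains Bs where "finite_dimensional_vector_space s Bs"
proof -
  interpret vector_space s by (rule vs)
  obtain B0 where B0: "finite B0" "span B0 = UNIV" using fin by blast
  obtain Bs where Bs: "independent Bs" "UNIV \<subseteq> span Bs" using basis_exists[of UNIV] by blast
  have "finite Bs" using independent_span_bound[OF B0(1) Bs(1)] B0(2) by auto
  then have "finite_dimensional_vector_space s Bs" using Bs by unfold_locales auto
  then show ?thesis by (rule that)
qed

section \<open>Nilpotency of ad\<close>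

text \<open>The additive combinations of the maps X^i \<circ> Y \<circ> X^j with i + j = k; the k-th power of
  ad X = (Z \<mapsto> X \<circ> Z - Z \<circ> X) applied to Y lies in this set.\<close>
inductive_set ad_terms :: "('v::ab_group_add \<Rightarrow> 'v) \<Rightarrow> ('v \<Rightarrow> 'v) \<Rightarrow> nat \<Rightarrow> ('v \<Rightarrow> 'v) set"
  for X Y k where
  zero: "(\<lambda>v. 0) \<in> ad_terms X Y k"
| monomial: "i + j = k \<Longrightarrow> (\<lambda>v. (X ^^ i) (Y ((X ^^ j) v))) \<in> ad_terms X Y k"
| diff: "Z1 \<in> ad_terms X Y k \<Longrightarrow> Z2 \<in> ad_terms X Y k \<Longrightarrow> (\<lambda>v. Z1 v - Z2 v) \<in> ad_terms X Y k"

lemma ad_terms_ad: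
  assumes Xadd: "\<And>a b. X (a + b) = X a + X b"
    and Z: "Z \<in> ad_terms X Y k"
  shows "(\<lambda>v. X (Z v) - Z (X v)) \<in> ad_terms X Y (Suc k)"
  using Z
proof induction
  case zero
  have "X 0 = 0" using additive_facts(1) Xadd by blast
  then show ?case using ad_terms.zero by simp
next
  case (monomial i j)
  have "(\<lambda>v. X ((X ^^ i) (Y ((X ^^ j) v))) - (X ^^ i) (Y ((X ^^ j) (X v))))
      = (\<lambda>v. (X ^^ Suc i) (Y ((X ^^ j) v)) - (X ^^ i) (Y ((X ^^ Suc j) v)))"
    by (simp add: funpow_swap1)
  moreover have "\<dots> \<in> ad_terms X Y (Suc k)"
    by (rule ad_terms.diff[OF ad_terms.monomial ad_terms.monomial]) (use monomial in simp_all)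
  ultimately show ?case by simp
next
  case (diff Z1 Z2)
  have Xdiff: "X (a - b) = X a - X b" for a b using additive_facts(3) Xadd by blast
  have "(\<lambda>v. X (Z1 v - Z2 v) - (Z1 (X v) - Z2 (X v)))
      = (\<lambda>v. (X (Z1 v) - Z1 (X v)) - (X (Z2 v) - Z2 (X v)))"
    by (simp add: Xdiff algebra_simps)
  then show ?case using ad_terms.diff[OF diff.IH] by simp
qed

text \<open>Every term X^i \<circ> Y \<circ> X^j with i + j \<ge> 2n vanishes if X^n = 0, since i \<ge> n or j \<ge> n.\<close>
lemma ad_terms_vanish:
  assumes Xn: "X ^^ n = (\<lambda>_. 0)" and X0: "X 0 = 0" and Y0: "Y 0 = (0::'v::ab_group_add)"
    and k: "2 * n \<le> k" and Z: "Z \<in> ad_terms X Y k"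
  shows "Z = (\<lambda>_. 0)"
  using Z
proof induction
  case (monomial i j)
  then consider "n \<le> j" | "n \<le> i" using k by linarith
  then show ?case
    by cases (use funpow_beyond_nil[OF Xn X0] Y0 funpow_fix_zero[of X, OF X0] in
              \<open>auto simp: fun_eq_iff\<close>)
qed simp_all

text \<open>If X^n = 0 then (ad X)^(2n) Y = 0, for additive X and Y.\<close>
lemma ad_nilpotent:
  assumes Xadd: "\<And>a b. X (a + b) = X a + X b" and Yadd: "\<And>a b. Y (a + b) = Y a + Y b"
    and Xn: "X ^^ n = (\<lambda>_. (0::'v::ab_group_add))"
  shows "((\<lambda>Z v. X (Z v) - Z (X v)) ^^ (2 * n)) Y = (\<lambda>_. 0)"
proof -
  have "((\<lambda>Z v. X (Z v) - Z (X v)) ^^ k) Y \<in> ad_terms X Y k" for k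
  proof (induction k)
    case 0
    have "(\<lambda>v. (X ^^ 0) (Y ((X ^^ 0) v))) \<in> ad_terms X Y 0" by (rule ad_terms.monomial) simp
    then show ?case by simp
  next
    case (Suc k)
    then show ?case using ad_terms_ad[OF Xadd Suc.IH] by simp
  qed
  moreover have "X 0 = 0" "Y 0 = 0" using additive_facts(1) Xadd Yadd by blast+
  ultimately show ?thesis using ad_terms_vanish[OF Xn] by blast
qed

section \<open>Engel's theorem for Leibniz algebras\<close>

text \<open>A finite-dimensional algebra L with left Leibniz product m and a subspace J with J L \<subseteq> J
  such that modulo J the product is alternating (squares and anticommutators lie in J, so
  L J \<subseteq> J as well) and every left multiplication m b is nilpotent modulo J.\<close>
locale engel_setting = finite_dimensional_vector_space scale Basis
  for scale :: "'f::field \<Rightarrow> 'l::ab_group_add \<Rightarrow> 'l" (infixr \<open>*s\<close> 75) and Basis +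
  fixes m :: "'l \<Rightarrow> 'l \<Rightarrow> 'l" and J :: "'l set"
  assumes m_add1: "\<And>x y z. m (x + y) z = m x z + m y z"
    and m_scale1: "\<And>c x z. m (c *s x) z = c *s m x z"
    and m_add2: "\<And>x y z. m z (x + y) = m z x + m z y"
    and m_scale2: "\<And>c x z. m z (c *s x) = c *s m z x"
    and leibniz: "\<And>x y z. m x (m y z) = m (m x y) z + m y (m x z)"
    and J_subspace: "subspace J"
    and J_ideal: "\<And>j u. j \<in> J \<Longrightarrow> m j u \<in> J"
    and J_square: "\<And>a. m a a \<in> J"
    and J_anticomm: "\<And>a b. m a b + m b a \<in> J"
    and J_ad_nil: "\<And>a b. \<exists>k. (m b ^^ k) a \<in> J"
begin

text \<open>Subalgebras containing J: these are the objects of the induction.\<close>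
definition subalg :: "'l set \<Rightarrow> bool" where
  "subalg K \<longleftrightarrow> subspace K \<and> J \<subseteq> K \<and> (\<forall>x\<in>K. \<forall>y\<in>K. m x y \<in> K)"

text \<open>K acts by \<rho> on U modulo the subspace U' (U \<not>\<subseteq> U'), J acts trivially modulo U', and every
  element of K acts nilpotently modulo U'.  This replaces the quotient module U/U'.\<close>
definition nil_action ::
  "('f \<Rightarrow> 'w::ab_group_add \<Rightarrow> 'w) \<Rightarrow> ('l \<Rightarrow> 'w \<Rightarrow> 'w) \<Rightarrow> 'l set \<Rightarrow> 'w set \<Rightarrow> 'w set \<Rightarrow> bool"
  where "nil_action sW \<rho> K U U' \<longleftrightarrow>
     (\<forall>x\<in>U'. \<forall>y\<in>U'. x + y \<in> U') \<and> (\<forall>c. \<forall>x\<in>U'. sW c x \<in> U') \<and> (\<exists>u\<in>U. u \<notin> U') \<and>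
     (\<forall>a\<in>K. \<forall>u\<in>U. \<rho> a u \<in> U) \<and> (\<forall>a\<in>K. \<forall>u\<in>U'. \<rho> a u \<in> U') \<and>
     (\<forall>j\<in>J. \<forall>u\<in>U. \<rho> j u \<in> U') \<and> (\<forall>a\<in>K. \<forall>u\<in>U. \<exists>k. (\<rho> a ^^ k) u \<in> U')"

text \<open>The conclusion of Engel's theorem: a vector of U outside U' killed by K modulo U'.\<close>
definition null_vector :: "('l \<Rightarrow> 'w \<Rightarrow> 'w) \<Rightarrow> 'l set \<Rightarrow> 'w set \<Rightarrow> 'w set \<Rightarrow> bool" where
  "null_vector \<rho> K U U' \<longleftrightarrow> (\<exists>u\<in>U. u \<notin> U' \<and> (\<forall>b\<in>K. \<rho> b u \<in> U'))"

text \<open>Proper inclusion of subspaces strictly increases the dimension.\<close>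
lemma subspace_dim_less:
  assumes "subspace A" "subspace B" "A \<subset> B"
  shows "dim A < dim B"
  using assms dim_psubset[of A B] by (simp del: span_eq_iff add: span_eq_iff[THEN iffD2])

text \<open>A subalgebra not contained in J has a proper subalgebra containing J of maximal dimension.\<close>
lemma maximal_proper_subalg:
  assumes K: "subalg K" and notJ: "\<not> K \<subseteq> J"
  obtains H where "subalg H" "H \<subset> K" "\<And>H'. subalg H' \<Longrightarrow> H' \<subset> K \<Longrightarrow> dim H' \<le> dim H"
proof -
  let ?P = "\<lambda>H. subalg H \<and> H \<subset> K"
  have "?P J" using K notJ J_subspace J_ideal unfolding subalg_def by auto
  moreover have "\<forall>H. ?P H \<longrightarrow> dim H < Suc (dim K)"
    by (auto simp: less_Suc_eq_le intro: dim_subset)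
  ultimately show ?thesis using ex_has_greatest_nat[of ?P J dim "Suc (dim K)"] that by blast
qed

text \<open>The elements of H + Fa, for a subspace H.\<close>
lemma span_insert_subspace:
  assumes "subspace H"
  shows "x \<in> span (insert a H) \<longleftrightarrow> (\<exists>c. x - c *s a \<in> H)"
  using assms by (simp add: span_insert del: span_eq_iff add: span_eq_iff[THEN iffD2])

text \<open>If a normalises a subalgebra H \<supseteq> J from the right, then H + Fa is a subalgebra:
  since ab + ba and aa lie in J \<subseteq> H, a normalises H from the left as well.\<close>
lemma subalg_insert_normalising:
  assumes H: "subalg H" and aN: "\<And>b. b \<in> H \<Longrightarrow> m b a \<in> H"
  shows "subalg (span (insert a H))"
proof -
  have Hsub: "subspace H" and JH: "J \<subseteq> H" and Hcl: "\<And>x y. x \<in> H \<Longrightarrow> y \<in> H \<Longrightarrow> m x y \<in> H"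
    using H unfolding subalg_def by auto
  have aN2: "m a b \<in> H" if "b \<in> H" for b
  proof -
    have "m a b = (m a b + m b a) - m b a" by simp
    moreover have "m a b + m b a \<in> H" using J_anticomm JH by blast
    ultimately show ?thesis using aN[OF that] Hsub subspace_diff by metis
  qed
  have "m x y \<in> span (insert a H)" if x_in: "x \<in> span (insert a H)" and y_in: "y \<in> span (insert a H)"
    for x y
  proof -
    obtain c1 h1 where h1: "h1 \<in> H" and x: "x = h1 + c1 *s a"
      using x_in span_insert_subspace[OF Hsub] by (metis diff_add_cancel)
    obtain c2 h2 where h2: "h2 \<in> H" and y: "y = h2 + c2 *s a"
      using y_in span_insert_subspace[OF Hsub] by (metis diff_add_cancel)
    have "m x y = m h1 h2 + c2 *s m h1 a + (c1 *s m a h2 + c1 *s (c2 *s m a a))"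
      unfolding x y m_add1 m_add2 m_scale1 m_scale2 by (simp add: scale_right_distrib add_ac mult.commute)
    also have "\<dots> \<in> H"
      using Hcl[OF h1 h2] aN[OF h1] aN2[OF h2] J_square JH Hsub
      by (intro subspace_add subspace_scale) auto
    finally show ?thesis by (intro span_base insertI2)
  qed
  then show ?thesis using JH unfolding subalg_def by (auto intro: span_base)
qed

text \<open>Let K = H + Fa with a normalising H.  If H has a null vector on U modulo U', the vectors
  of U killed by H form an a-invariant set; iterating a on it, a nilpotent map modulo U', yields a
  null vector of K.\<close>
lemma null_vector_extend:
  fixes sW :: "'f \<Rightarrow> 'w::ab_group_add \<Rightarrow> 'w" and \<rho> :: "'l \<Rightarrow> 'w \<Rightarrow> 'w"
  assumes \<rho>_add: "\<And>x y w. \<rho> (x + y) w = \<rho> x w + \<rho> y w"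
    and \<rho>_scale: "\<And>c x w. \<rho> (c *s x) w = sW c (\<rho> x w)"
    and \<rho>_hom: "\<And>x y w. \<rho> x (\<rho> y w) = \<rho> (m x y) w + \<rho> y (\<rho> x w)"
    and U: "nil_action sW \<rho> K U U'"
    and aK: "a \<in> K" and aN: "\<And>b. b \<in> H \<Longrightarrow> m b a \<in> H"
    and K_gen: "\<And>b. b \<in> K \<Longrightarrow> \<exists>c. b - c *s a \<in> H"
    and nullH: "null_vector \<rho> H U U'"
  shows "null_vector \<rho> K U U'"
proof -
  obtain u0 where u0: "u0 \<in> U" "u0 \<notin> U'" "\<forall>b\<in>H. \<rho> b u0 \<in> U'"
    using nullH unfolding null_vector_def by blast
  define W where "W = {u\<in>U. \<forall>b\<in>H. \<rho> b u \<in> U'}"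
  have U'add: "\<And>x y. x \<in> U' \<Longrightarrow> y \<in> U' \<Longrightarrow> x + y \<in> U'"
    and U'scale: "\<And>c x. x \<in> U' \<Longrightarrow> sW c x \<in> U'"
    using U unfolding nil_action_def by auto
  have W_inv: "\<forall>w\<in>W. \<rho> a w \<in> W"
  proof
    fix w assume w: "w \<in> W"
    have "\<rho> a w \<in> U" using U aK w unfolding nil_action_def W_def by blast
    moreover have "\<rho> b (\<rho> a w) \<in> U'" if b: "b \<in> H" for b
    proof -
      have "\<rho> (m b a) w \<in> U'" using aN[OF b] w unfolding W_def by blast
      moreover have "\<rho> a (\<rho> b w) \<in> U'" using w b U aK unfolding W_def nil_action_def by blast
      ultimately show ?thesis using \<rho>_hom[of b a w] U'add by simp
    qed
    ultimately show "\<rho> a w \<in> W" unfolding W_def by blast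
  qed
  obtain k where "(\<rho> a ^^ k) u0 \<in> U'" using U aK u0 unfolding nil_action_def by blast
  then obtain w where w: "w \<in> W" "w \<notin> U'" "\<rho> a w \<in> U'"
    using funpow_exit[OF W_inv, of u0 U' k] u0 unfolding W_def by blast
  have "\<rho> b w \<in> U'" if bK: "b \<in> K" for b
  proof -
    obtain c where c: "b - c *s a \<in> H" using K_gen bK by blast
    have "\<rho> b w = \<rho> (b - c *s a) w + sW c (\<rho> a w)"
      using \<rho>_add[of "b - c *s a" "c *s a" w] \<rho>_scale by simp
    then show ?thesis using c w U'add U'scale unfolding W_def by auto
  qed
  then show ?thesis using w unfolding null_vector_def W_def by blast
qed

text \<open>The induction step of Engel's theorem.  IH_adj is the induction hypothesis for the adjoint
  action of smaller subalgebras, IH for the action \<rho>.\<close>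
lemma engel_step:
  fixes sW :: "'f \<Rightarrow> 'w::ab_group_add \<Rightarrow> 'w" and \<rho> :: "'l \<Rightarrow> 'w \<Rightarrow> 'w"
  assumes IH_adj: "\<And>K' V V'. dim K' < dim K \<Longrightarrow> subalg K' \<Longrightarrow>
                       nil_action (*s) m K' V V' \<Longrightarrow> null_vector m K' V V'"
    and IH: "\<And>K' V V'. dim K' < dim K \<Longrightarrow> subalg K' \<Longrightarrow>
                       nil_action sW \<rho> K' V V' \<Longrightarrow> null_vector \<rho> K' V V'"
    and \<rho>_add: "\<And>x y w. \<rho> (x + y) w = \<rho> x w + \<rho> y w"
    and \<rho>_scale: "\<And>c x w. \<rho> (c *s x) w = sW c (\<rho> x w)"
    and \<rho>_hom: "\<And>x y w. \<rho> x (\<rho> y w) = \<rho> (m x y) w + \<rho> y (\<rho> x w)"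
    and K: "subalg K" and U: "nil_action sW \<rho> K U U'"
  shows "null_vector \<rho> K U U'"
proof (cases "K \<subseteq> J")
  case True
  then show ?thesis using U unfolding nil_action_def null_vector_def by blast
next
  case False
  obtain H where H: "subalg H" "H \<subset> K" and H_max: "\<And>H'. subalg H' \<Longrightarrow> H' \<subset> K \<Longrightarrow> dim H' \<le> dim H"
    using maximal_proper_subalg[OF K False] by blast
  have Hsub: "subspace H" and JH: "J \<subseteq> H" and Ksub: "subspace K"
    and Kcl: "\<And>x y. x \<in> K \<Longrightarrow> y \<in> K \<Longrightarrow> m x y \<in> K"
    using H K unfolding subalg_def by auto
  have dim_HK: "dim H < dim K" using subspace_dim_less Hsub Ksub H(2) by blast
  have "nil_action (*s) m H K H"
    unfolding nil_action_def
  proof (intro conjI)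
    show "\<forall>x\<in>H. \<forall>y\<in>H. x + y \<in> H" "\<forall>c. \<forall>x\<in>H. c *s x \<in> H"
      using Hsub by (auto simp: subspace_def)
    show "\<exists>u\<in>K. u \<notin> H" using H(2) by blast
    show "\<forall>a\<in>H. \<forall>u\<in>K. m a u \<in> K" using H(2) Kcl by blast
    show "\<forall>a\<in>H. \<forall>u\<in>H. m a u \<in> H" using H(1) unfolding subalg_def by blast
    show "\<forall>j\<in>J. \<forall>u\<in>K. m j u \<in> H" using J_ideal JH by blast
    show "\<forall>a\<in>H. \<forall>u\<in>K. \<exists>k. (m a ^^ k) u \<in> H" using J_ad_nil JH by blast
  qed
  then obtain a where aK: "a \<in> K" and aH: "a \<notin> H" and aN: "\<And>b. b \<in> H \<Longrightarrow> m b a \<in> H"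
    using IH_adj[OF dim_HK H(1)] unfolding null_vector_def by blast
  let ?H' = "span (insert a H)"
  have H'K: "?H' \<subseteq> K" using span_minimal[of "insert a H" K] aK H(2) Ksub by auto
  have "?H' = K"
  proof (rule ccontr)
    assume "?H' \<noteq> K"
    then have "dim ?H' \<le> dim H"
      using H_max subalg_insert_normalising[OF H(1) aN] H'K by blast
    moreover have "H \<subset> ?H'" using aH span_superset[of "insert a H"] span_base[of a] by auto
    then have "dim H < dim ?H'" using subspace_dim_less Hsub by blast
    ultimately show False by simp
  qed
  then have K_gen: "\<And>b. b \<in> K \<Longrightarrow> \<exists>c. b - c *s a \<in> H"
    using span_insert_subspace[OF Hsub] by blast
  have "nil_action sW \<rho> H U U'" using U H(2) unfolding nil_action_def by blast
  then have "null_vector \<rho> H U U'" using IH[OF dim_HK H(1)] by blast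
  then show ?thesis using null_vector_extend[OF \<rho>_add \<rho>_scale \<rho>_hom U aK aN K_gen] by blast
qed

text \<open>Engel's theorem for the adjoint action, by induction on the dimension.\<close>
lemma engel_adjoint: "subalg K \<Longrightarrow> nil_action (*s) m K U U' \<Longrightarrow> null_vector m K U U'"
proof (induction "dim K" arbitrary: K U U' rule: less_induct)
  case less
  show ?case by (rule engel_step[OF less(1) less(1) m_add1 m_scale1 leibniz less(2) less(3)])
qed

text \<open>Engel's theorem for an arbitrary action \<rho> of the Leibniz algebra.\<close>
lemma engel:
  fixes sW :: "'f \<Rightarrow> 'w::ab_group_add \<Rightarrow> 'w" and \<rho> :: "'l \<Rightarrow> 'w \<Rightarrow> 'w"
  assumes \<rho>_add: "\<And>x y w. \<rho> (x + y) w = \<rho> x w + \<rho> y w"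
    and \<rho>_scale: "\<And>c x w. \<rho> (c *s x) w = sW c (\<rho> x w)"
    and \<rho>_hom: "\<And>x y w. \<rho> x (\<rho> y w) = \<rho> (m x y) w + \<rho> y (\<rho> x w)"
  shows "subalg K \<Longrightarrow> nil_action sW \<rho> K U U' \<Longrightarrow> null_vector \<rho> K U U'"
proof (induction "dim K" arbitrary: K U U' rule: less_induct)
  case less
  show ?case
    by (rule engel_step[OF _ less(1) \<rho>_add \<rho>_scale \<rho>_hom less(2) less(3)]) (rule engel_adjoint)
qed

end

text \<open>Engel's theorem for a representation T of a finite-dimensional left Leibniz algebra by
  nilpotent maps: every nonzero T-invariant set contains a nonzero vector killed by all T_b.
  The ideal used is the kernel of T, on which T_(b^k a) = (ad T_b)^k T_a gives nilpotency of ad.\<close>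
lemma leibniz_rep_engel:
  fixes sL :: "'f::field \<Rightarrow> 'l::ab_group_add \<Rightarrow> 'l" and sV :: "'f \<Rightarrow> 'v::ab_group_add \<Rightarrow> 'v"
    and m :: "'l \<Rightarrow> 'l \<Rightarrow> 'l" and T :: "'l \<Rightarrow> 'v \<Rightarrow> 'v"
  assumes L: "finite_dimensional_vector_space sL BL" and V: "vector_space sV"
    and m_lin1: "\<forall>a. Vector_Spaces.linear sL sL (m a)"
    and m_lin2: "\<forall>b. Vector_Spaces.linear sL sL (\<lambda>a. m a b)"
    and leibL: "left_leibniz m"
    and T_lin1: "\<forall>a. Vector_Spaces.linear sV sV (T a)"
    and T_lin2: "\<forall>v. Vector_Spaces.linear sL sV (\<lambda>a. T a v)"
    and T_hom: "\<And>a b w. T a (T b w) = T (m a b) w + T b (T a w)"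
    and T_nil: "\<forall>a. nilpotent_map (T a)"
    and U_nonzero: "\<exists>u\<in>U. u \<noteq> 0" and U_inv: "\<forall>a. \<forall>u\<in>U. T a u \<in> U"
  shows "\<exists>u\<in>U. u \<noteq> 0 \<and> (\<forall>b. T b u = 0)"
proof -
  interpret L: finite_dimensional_vector_space sL BL by (rule L)
  interpret V: vector_space sV by (rule V)
  have T_add1: "\<And>a x y. T a (x + y) = T a x + T a y"
    using T_lin1[unfolded Vector_Spaces.linear_iff] by auto
  have T_add2: "\<And>a b v. T (a + b) v = T a v + T b v"
    and T_scale2: "\<And>a c v. T (sL c a) v = sV c (T a v)"
    using T_lin2[unfolded Vector_Spaces.linear_iff] by auto
  have T0: "T a 0 = 0" for a using additive_facts(1)[of "T a"] T_add1 by blast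
  have T0': "T 0 v = 0" for v using additive_facts(1)[of "\<lambda>a. T a v"] T_add2 by blast
  have T_comm: "T (m a b) w = T a (T b w) - T b (T a w)" for a b w
    using T_hom[of a b w] by (simp add: algebra_simps)
  define J where "J = {a. \<forall>v. T a v = 0}"
  have J_ad_nil: "\<exists>k. (m b ^^ k) a \<in> J" for a b
  proof -
    obtain n where n: "T b ^^ n = (\<lambda>_. 0)" using T_nil unfolding nilpotent_map_def by blast
    let ?ad = "\<lambda>Z v. T b (Z v) - Z (T b v)"
    have T_iter: "T ((m b ^^ k) a) = (?ad ^^ k) (T a)" for k
    proof (induction k)
      case (Suc k)
      have "T ((m b ^^ Suc k) a) = (\<lambda>w. T b (T ((m b ^^ k) a) w) - T ((m b ^^ k) a) (T b w))"
        by (rule ext) (simp only: funpow.simps comp_apply T_comm)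
      then show ?case by (simp only: Suc.IH funpow.simps comp_apply)
    qed simp
    have "(?ad ^^ (2 * n)) (T a) = (\<lambda>_. 0)" by (rule ad_nilpotent) (use T_add1 n in auto)
    then have "\<forall>v. T ((m b ^^ (2 * n)) a) v = 0" unfolding T_iter by simp
    then show ?thesis unfolding J_def by blast
  qed
  interpret E: engel_setting sL BL m J
  proof unfold_locales
    show "\<And>x y z. m (x + y) z = m x z + m y z" "\<And>c x z. m (sL c x) z = sL c (m x z)"
      using m_lin2 unfolding Vector_Spaces.linear_iff by auto
    show "\<And>x y z. m z (x + y) = m z x + m z y" "\<And>c x z. m z (sL c x) = sL c (m z x)"
      using m_lin1 unfolding Vector_Spaces.linear_iff by auto
    show "\<And>x y z. m x (m y z) = m (m x y) z + m y (m x z)"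
      using leibL unfolding left_leibniz_def by blast
    show "L.subspace J" unfolding L.subspace_def J_def
      using T0' T_add2 T_scale2 V.scale_zero_right by simp
    show "\<And>j u. j \<in> J \<Longrightarrow> m j u \<in> J" "\<And>a. m a a \<in> J"
      unfolding J_def using T_comm T0 by simp_all
    show "\<And>a b. m a b + m b a \<in> J" unfolding J_def using T_comm T_add2 by simp
  qed (rule J_ad_nil)
  have "E.subalg UNIV" unfolding E.subalg_def by simp
  moreover have "E.nil_action sV T UNIV U {0}"
    unfolding E.nil_action_def
  proof (intro conjI)
    show "\<forall>x\<in>{0}. \<forall>y\<in>{0}. x + y \<in> {0::'v}" "\<forall>c. \<forall>x\<in>{0}. sV c x \<in> {0}"
      "\<forall>a\<in>UNIV. \<forall>u\<in>{0}. T a u \<in> {0}" "\<forall>j\<in>J. \<forall>u\<in>U. T j u \<in> {0}"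
      using T0 V.scale_zero_right unfolding J_def by simp_all
    show "\<exists>u\<in>U. u \<notin> {0}" "\<forall>a\<in>UNIV. \<forall>u\<in>U. T a u \<in> U" using U_nonzero U_inv by auto
    show "\<forall>a\<in>UNIV. \<forall>u\<in>U. \<exists>k. (T a ^^ k) u \<in> {0}"
      using T_nil unfolding nilpotent_map_def by (metis singletonI)
  qed
  ultimately have "E.null_vector T UNIV U {0}" by (rule E.engel[OF T_add2 T_scale2 T_hom])
  then show ?thesis unfolding E.null_vector_def by auto
qed

section \<open>Bimodules of Leibniz algebras\<close>

text \<open>The left Leibniz identity of the split extension on the triples (a,b,w), (a,v,c) and
  (u,b,c) gives the three defining identities of a Leibniz bimodule.\<close>
lemma split_ext_identities:
  fixes m :: "'l::plus \<Rightarrow> 'l \<Rightarrow> 'l" and T :: "'l \<Rightarrow> 'v::monoid_add \<Rightarrow> 'v"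
    and S :: "'v \<Rightarrow> 'l \<Rightarrow> 'v"
  assumes bimod: "left_leibniz (split_ext_mult m T S)"
    and T0: "\<And>a. T a 0 = 0" and S0: "\<And>a. S 0 a = 0"
  shows "T a (T b w) = T (m a b) w + T b (T a w)"
    and "T a (S v c) = S (T a v) c + S v (m a c)"
    and "S u (m b c) = S (S u b) c + T b (S u c)"
proof -
  have B: "\<And>x y z. split_ext_mult m T S x (split_ext_mult m T S y z) =
     split_ext_mult m T S (split_ext_mult m T S x y) z + split_ext_mult m T S y (split_ext_mult m T S x z)"
    using bimod unfolding left_leibniz_def by blast
  show "T a (T b w) = T (m a b) w + T b (T a w)"
    using B[of "(0, a)" "(0, b)" "(w, c)"] by (simp add: split_ext_mult_def T0 S0)
  show "T a (S v c) = S (T a v) c + S v (m a c)"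
    using B[of "(0, a)" "(v, b)" "(0, c)"] by (simp add: split_ext_mult_def T0 S0)
  show "S u (m b c) = S (S u b) c + T b (S u c)"
    using B[of "(u, a)" "(0, b)" "(0, c)"] by (simp add: split_ext_mult_def T0 S0)
qed

text \<open>Subtracting the second identity (with a = b) from the third: S_c S_b = - S_c T_b.\<close>
lemma right_action_twice:
  fixes T :: "'l \<Rightarrow> 'v::ab_group_add \<Rightarrow> 'v" and S :: "'v \<Rightarrow> 'l \<Rightarrow> 'v"
  assumes left_right: "\<And>a v c. T a (S v c) = S (T a v) c + S v (m a c)"
    and right_right: "\<And>u b c. S u (m b c) = S (S u b) c + T b (S u c)"
  shows "S (S u b) c = - S (T b u) c"
proof -
  have "S u (m b c) = S (S u b) c + (S (T b u) c + S u (m b c))"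
    using right_right left_right by simp
  then show ?thesis by (simp add: eq_neg_iff_add_eq_0 add.assoc[symmetric])
qed

text \<open>If f is additive and f \<circ> f = - f \<circ> g, then f^(k+1) = \<plusminus> f \<circ> g^k; hence f is nilpotent
  whenever g is nilpotent and f 0 = 0.\<close>
lemma nilpotent_by_square:
  fixes f g :: "'v::ab_group_add \<Rightarrow> 'v"
  assumes f_add: "\<And>x y. f (x + y) = f x + f y"
    and ff: "\<And>x. f (f x) = - f (g x)" and g_nil: "nilpotent_map g"
  shows "nilpotent_map f"
proof -
  have f_neg: "f (- x) = - f x" for x using additive_facts(2) f_add by blast
  have powers: "(f ^^ Suc k) x = f ((g ^^ k) x) \<or> (f ^^ Suc k) x = - f ((g ^^ k) x)" for k x
  proof (induction k)
    case (Suc k)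
    then show ?case using ff[of "(g ^^ k) x"] by (auto simp: f_neg)
  qed simp
  obtain n where "g ^^ n = (\<lambda>_. 0)" using g_nil unfolding nilpotent_map_def by blast
  moreover have "f 0 = 0" using additive_facts(1) f_add by blast
  ultimately have "f ^^ Suc n = (\<lambda>_. 0)" using powers[of n] by (auto simp: fun_eq_iff)
  then show ?thesis unfolding nilpotent_map_def by blast
qed

text \<open>The second part of the theorem, given Engel's theorem for T: if v \<noteq> 0 is killed by all
  T_a but S_v b \<noteq> 0 for some b, then S_v b lies in the T-invariant set {u. S_u = 0}, and a
  nonzero T-null vector there is killed by both actions.\<close>
lemma bimodule_null_vector:
  fixes T :: "'l \<Rightarrow> 'v::ab_group_add \<Rightarrow> 'v" and S :: "'v \<Rightarrow> 'l \<Rightarrow> 'v"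
  assumes engel: "\<And>U. \<exists>u\<in>U. u \<noteq> 0 \<Longrightarrow> \<forall>a. \<forall>u\<in>U. T a u \<in> U \<Longrightarrow>
                      \<exists>u\<in>U. u \<noteq> 0 \<and> (\<forall>b. T b u = 0)"
    and V_nonzero: "\<exists>v::'v. v \<noteq> 0"
    and left_right: "\<And>a v c. T a (S v c) = S (T a v) c + S v (m a c)"
    and right_twice: "\<And>u b c. S (S u b) c = - S (T b u) c"
    and T0: "\<And>a. T a 0 = 0" and S0: "\<And>a. S 0 a = 0"
  shows "\<exists>v. v \<noteq> 0 \<and> (\<forall>a. T a v = 0 \<and> S v a = 0)"
proof -
  obtain v where v: "v \<noteq> 0" "\<forall>b. T b v = 0" using engel[of UNIV] V_nonzero by auto
  show ?thesis
  proof (cases "\<forall>a. S v a = 0")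
    case True
    then show ?thesis using v by blast
  next
    case False
    then obtain b where b: "S v b \<noteq> 0" by blast
    define Z where "Z = {u. \<forall>c. S u c = 0}"
    have "S v b \<in> Z" unfolding Z_def using right_twice[of v b] v(2) S0 by simp
    moreover have "\<forall>a. \<forall>u\<in>Z. T a u \<in> Z"
    proof (intro allI ballI)
      fix a u assume "u \<in> Z"
      then show "T a u \<in> Z" using left_right[of a u] T0 unfolding Z_def by simp
    qed
    ultimately obtain u where "u \<in> Z" "u \<noteq> 0" "\<forall>b. T b u = 0" using engel[of Z] b by blast
    then show ?thesis unfolding Z_def by blast
  qed
qed

section \<open>The theorem\<close>

text \<open>Left actions nilpotent imply right actions nilpotent, and a common null vector exists.\<close>
theorem theorem2:
  fixes sL :: "'f::field \<Rightarrow> 'l::ab_group_add \<Rightarrow> 'l"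
    and sV :: "'f \<Rightarrow> 'v::ab_group_add \<Rightarrow> 'v"
    and m :: "'l \<Rightarrow> 'l \<Rightarrow> 'l"
    and T :: "'l \<Rightarrow> 'v \<Rightarrow> 'v"
    and S :: "'v \<Rightarrow> 'l \<Rightarrow> 'v"
  assumes vsL: "vector_space sL"
    and vsV: "vector_space sV"
    and finL: "\<exists>B. finite B \<and> module.span sL B = UNIV"
    and finV: "\<exists>B. finite B \<and> module.span sV B = UNIV"
    and m_lin1: "\<forall>a. Vector_Spaces.linear sL sL (m a)"
    and m_lin2: "\<forall>b. Vector_Spaces.linear sL sL (\<lambda>a. m a b)"
    and leibL: "left_leibniz m"
    and T_lin1: "\<forall>a. Vector_Spaces.linear sV sV (T a)"
    and T_lin2: "\<forall>v. Vector_Spaces.linear sL sV (\<lambda>a. T a v)"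
    and S_lin1: "\<forall>a. Vector_Spaces.linear sV sV (\<lambda>v. S v a)"
    and S_lin2: "\<forall>v. Vector_Spaces.linear sL sV (S v)"
    and bimod: "left_leibniz (split_ext_mult m T S)"
    and V_nonzero: "\<exists>v::'v. v \<noteq> 0"
    and T_nil: "\<forall>a. nilpotent_map (T a)"
  shows "(\<forall>a. nilpotent_map (\<lambda>v. S v a)) \<and>
         (\<exists>v. v \<noteq> 0 \<and> (\<forall>a. T a v = 0 \<and> S v a = 0))"
proof -
  obtain BL where L: "finite_dimensional_vector_space sL BL"
    using finite_dimensional_from_finite_span[OF vsL finL] by blast
  have T_add: "\<And>a x y. T a (x + y) = T a x + T a y"
    using T_lin1[unfolded Vector_Spaces.linear_iff] by auto
  have S_add: "\<And>a x y. S (x + y) a = S x a + S y a"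
    using S_lin1[unfolded Vector_Spaces.linear_iff] by auto
  have T0: "T a 0 = 0" for a using additive_facts(1)[of "T a"] T_add by blast
  have S0: "S 0 a = 0" for a using additive_facts(1)[of "\<lambda>v. S v a"] S_add by blast
  note identities = split_ext_identities[OF bimod T0 S0]
  have right_twice: "S (S u b) c = - S (T b u) c" for u b c
    by (rule right_action_twice[OF identities(2,3)])
  have "nilpotent_map (\<lambda>v. S v a)" for a
    using nilpotent_by_square[of "\<lambda>v. S v a" "T a", OF S_add right_twice] T_nil by blast
  moreover have "\<exists>v. v \<noteq> 0 \<and> (\<forall>a. T a v = 0 \<and> S v a = 0)"
    by (rule bimodule_null_vector[OF leibniz_rep_engel[OF L vsV m_lin1 m_lin2 leibL T_lin1 T_lin2
            identities(1) T_nil] V_nonzero identities(2) right_twice T0 S0])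
  ultimately show ?thesis by blast
qed

end
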